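(* Let $\alpha(x):=\ln^2(1+e^x)$ and $w(x):=2\pi^{-1/2}(1+e^{-x})^{-1}$ for $x\in\mathbb R$. For an arbitrary but fixed $\delta\in(0,1)$ choose some $$h\in\Bigl(0,\frac{\pi^2}{5(|\ln(\delta/2)|+4)}\Bigr]$$ and set $n^+:=\bigl\lceil h^{-1}\max\{4\pi^{-1/2},\sqrt{|\ln(\delta/2)|}\}\bigr\rceil$. Define $$\varphi_{h,n}(t):=\sum_{k=-n}^{n^+}h\,w(kh)\,e^{-\alpha(kh)\,t},\qquad \varphi_{h,\infty}(t):=\lim_{n\to\infty}\varphi_{h,n}(t).$$ Then $$\Bigl|\frac1{\sqrt t}-\varphi_{h,\infty}(t)\Bigr|\le\frac{\delta}{\sqrt t}\quad\text{for all }t\in[1,\infty).$$ Moreover, for any $\eta>0$ and $T>1$, provided that $n\ge\bigl\lceil h^{-1}\bigl(\ln(2\pi^{-1/2})+|\ln(\min\{\delta/2,\eta\})|+\tfrac12\ln T\bigr)\bigr\rceil$, one has in addition $$\bigl|t^{-1/2}-\varphi_{h,n}(t)\bigr|\le\frac{\delta}{\sqrt t}\quad\text{and}\quad\bigl|\varphi_{h,\infty}(t)-\varphi_{h,n}(t)\bigr|\le\frac{\eta}{\sqrt t}\quad\text{for all }t\in[1,T].$$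
   Context: All objects are defined in the claim; $n$ is a natural number and $\lceil\cdot\rceil$ denotes the ceiling function. *)

theory Defs
  imports "HOL-Analysis.Analysis"
begin

definition alpha :: "real \<Rightarrow> real" where
  "alpha x = (ln (1 + exp x))\<^sup>2"

definition w :: "real \<Rightarrow> real" where
  "w x = 2 * pi powr (-1/2) * inverse (1 + exp (- x))"

definition n_plus :: "real \<Rightarrow> real \<Rightarrow> int" where
  "n_plus \<delta> h = \<lceil>inverse h * max (4 * pi powr (-1/2)) (sqrt \<bar>ln (\<delta>/2)\<bar>)\<rceil>"

text \<open>The upper summation bound depends on \<open>\<delta>\<close>, which is therefore an explicit argument.\<close>

definition phi :: "real \<Rightarrow> real \<Rightarrow> nat \<Rightarrow> real \<Rightarrow> real" where
  "phi \<delta> h n t =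
     (\<Sum>k\<in>{- int n..n_plus \<delta> h}. h * w (of_int k * h) * exp (- alpha (of_int k * h) * t))"

definition phi_inf :: "real \<Rightarrow> real \<Rightarrow> real \<Rightarrow> real" where
  "phi_inf \<delta> h t = lim (\<lambda>n. phi \<delta> h n t)"

text \<open>\<^const>\<open>lim\<close> is only meaningful for convergent sequences; here convergence always holds.\<close>

lemma phi_tendsto_phi_inf:
  assumes h: "h > 0" and t: "t \<ge> 0"
  shows "(\<lambda>n. phi \<delta> h n t) \<longlonglongrightarrow> phi_inf \<delta> h t"
proof -
  define f where "f k = h * w (of_int k * h) * exp (- alpha (of_int k * h) * t)" for k :: int
  have N: "n_plus \<delta> h \<ge> 0"
  proof -
    have "0 \<le> inverse h * max (4 * pi powr (-1/2)) (sqrt \<bar>ln (\<delta>/2)\<bar>)"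
      using h by (intro mult_nonneg_nonneg) (auto simp: le_max_iff_disj)
    then show ?thesis
      unfolding n_plus_def by (simp add: le_ceiling_iff)
  qed
  have step: "phi \<delta> h (Suc n) t = phi \<delta> h n t + f (- int (Suc n))" for n
  proof -
    have "{- int (Suc n)..n_plus \<delta> h} = insert (- int (Suc n)) {- int n..n_plus \<delta> h}"
      using N by auto
    then show ?thesis
      by (simp add: phi_def f_def)
  qed
  have eq: "phi \<delta> h n t = phi \<delta> h 0 t + (\<Sum>i<n. f (- int (Suc i)))" for n
    by (induction n) (simp_all only: step, simp_all)
  have bound: "norm (f (- int (Suc i))) \<le> h * (2 * pi powr (-1/2)) * exp (- h) ^ Suc i" for i
  proof -
    define x where "x = of_int (- int (Suc i)) * h"
    have "exp (- h) ^ Suc i = exp x"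
      unfolding x_def by (subst exp_of_nat_mult[symmetric]) (simp add: algebra_simps)
    moreover have "w x \<le> 2 * pi powr (-1/2) * exp x"
    proof -
      have "inverse (1 + exp (- x)) \<le> inverse (exp (- x))"
        by (intro le_imp_inverse_le) auto
      then show ?thesis
        unfolding w_def by (intro mult_left_mono) (simp_all add: exp_minus)
    qed
    moreover have "0 \<le> w x"
      unfolding w_def by (intro mult_nonneg_nonneg) auto
    moreover have "exp (- alpha x * t) \<le> 1"
      using t by (simp add: alpha_def)
    ultimately have "h * w x * exp (- alpha x * t) \<le> h * (2 * pi powr (-1/2) * exp (- h) ^ Suc i) * 1"
      using h by (intro mult_mono mult_nonneg_nonneg order_refl) (simp_all only: exp_ge_zero powr_ge_zero zero_le_numeral zero_le_power less_imp_le)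
    moreover have "0 \<le> h * w x * exp (- alpha x * t)"
      using h \<open>0 \<le> w x\<close> by (intro mult_nonneg_nonneg) auto
    ultimately show ?thesis
      unfolding f_def x_def[symmetric] real_norm_def by (simp only: mult.assoc abs_of_nonneg mult_1_right)
  qed
  have "summable (\<lambda>i. h * (2 * pi powr (-1/2)) * exp (- h) ^ Suc i)"
    using h by (intro summable_mult iffD2[OF summable_Suc_iff] summable_geometric) simp
  then have "summable (\<lambda>i. f (- int (Suc i)))"
    by (rule summable_comparison_test') (rule bound)
  then have "convergent (\<lambda>n. phi \<delta> h n t)"
    by (subst eq) (intro convergent_add convergent_const, simp only: summable_iff_convergent)
  then show ?thesis
    unfolding phi_inf_def convergent_LIMSEQ_iff .
qed

end

theory Submission
  imports Defs "HOL-Complex_Analysis.Complex_Analysis" "HOL-Probability.Distributions"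
    "HOL-Real_Asymp.Real_Asymp"
begin

text \<open>
  The substitution \<open>u = ln (1 + exp x)\<close> turns the Gaussian integral \<open>1 / sqrt t = 2 / sqrt \<pi> \<integral>\<^sub>0\<^sup>\<infinity> exp (- t u\<^sup>2) du\<close>
  into \<open>1 / sqrt t = \<integral> w(x) exp (- \<alpha>(x) t) dx\<close> over the whole real line, and \<open>\<phi>\<close> is a truncated trapezoidal
  sum for this integral. The substitution is chosen so that the integrand extends holomorphically to
  the strip \<open>\<bar>Im z\<bar> < \<pi>/2\<close>. For such integrands the trapezoidal rule converges exponentially fast in \<open>1/h\<close>.

  There are three errors. The first is that of the full two-sided trapezoidal sum. Integrating the integrand
  times \<open>1 / (exp (2 \<pi> \<i> z / h) - 1)\<close> around a rectangle of half height \<open>d\<close> produces the sum by residues, and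
  it differs from the integral by about \<open>q = exp (- 2 \<pi> d / h)\<close> times the integrals of the modulus along
  the two horizontal lines (lemma \<open>trapezoidal_rule_on_strip\<close>). With \<open>d = \<pi>/10\<close> the bound on \<open>h\<close> gives
  \<open>q \<le> exp (- 4) \<delta>/2\<close>. On the lines, \<open>ln (1 + exp z)\<close> stays so close to its value at \<open>Re z\<close> that
  the modulus is at most \<open>sqrt 2\<close> times the real integrand with \<open>t/16\<close> in place of \<open>t\<close> (lemma
  \<open>norm_complex_integrand_le\<close>). The real integral is then used once more, and gives \<open>4 / sqrt t\<close> for its
  integral. Altogether this error is at most \<open>3\<delta>/8\<close>, relative to \<open>1 / sqrt t\<close> (lemma \<open>error_constant\<close>).

  The second error comes from the terms above \<open>n\<^sup>+\<close>. As \<open>\<alpha>(x) \<ge> x\<^sup>2\<close> for \<open>x \<ge> 0\<close>, these are dominated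
  by a geometric series; the two quantities in the maximum defining \<open>n\<^sup>+\<close> bring in the factors \<open>\<delta>/2\<close> and
  \<open>1/4\<close>, so this error is at most \<open>\<delta>/8\<close> (lemma \<open>upper_tail\<close>). Both errors together are at most
  \<open>\<delta>/2\<close>, relative to \<open>1 / sqrt t\<close>.

  The third error comes from the terms below \<open>-n\<close>. Here \<open>w(x) \<le> 2 / sqrt \<pi> exp x\<close> gives another geometric series, of
  sum at most \<open>2 / sqrt \<pi> exp (- n h)\<close> (lemma \<open>lower_tail\<close>), and \<open>n\<close> is chosen to bring this down
  to \<open>min (\<delta>/2) \<eta> / sqrt T\<close>. This can consume both the second half of \<open>\<delta>\<close> and the whole of \<open>\<eta>\<close>.
\<close>

section \<open>Contour integrals over rectangles\<close>

lemma contour_integral_horizontal_segment: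
  fixes F :: "complex \<Rightarrow> complex"
  assumes "a < b"
  shows "contour_integral (linepath (Complex a y) (Complex b y)) F =
           integral {a..b} (\<lambda>x. F (Complex x y))"
proof -
  have line: "linepath (Complex a y) (Complex b y) x =
      linepath (complex_of_real a) (of_real b) x + \<i> * of_real y" for x
    by (simp add: linepath_def complex_eq_iff algebra_simps)
  have "contour_integral (linepath (Complex a y) (Complex b y)) F =
          contour_integral (linepath (of_real a) (of_real b)) (\<lambda>z. F (z + \<i> * of_real y))"
    unfolding contour_integral_integral vector_derivative_linepath_at line
    by (rule integral_cong) (simp add: complex_eq_iff)
  also have "\<dots> = integral {a..b} (\<lambda>x. F (of_real x + \<i> * of_real y))"
    using assms by (subst contour_integral_linepath_Reals_eq) auto
  also have "(\<lambda>x. F (of_real x + \<i> * of_real y)) = (\<lambda>x. F (Complex x y))"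
    by (simp add: Complex_eq)
  finally show ?thesis .
qed

text \<open>
  Only the horizontal sides of the rectangle matter for the trapezoidal rule: the vertical sides move to infinity,
  and a crude bound on them is enough.
\<close>

lemma contour_integral_rectpath_approx:
  fixes F :: "complex \<Rightarrow> complex"
  assumes ab: "a < b" and cd: "c < d"
    and cont: "continuous_on (path_image (rectpath (Complex a c) (Complex b d))) F"
    and left: "\<And>y. y \<in> {c..d} \<Longrightarrow> norm (F (Complex a y)) \<le> A"
    and right: "\<And>y. y \<in> {c..d} \<Longrightarrow> norm (F (Complex b y)) \<le> B"
  shows "norm (contour_integral (rectpath (Complex a c) (Complex b d)) F -
           (integral {a..b} (\<lambda>x. F (Complex x c)) - integral {a..b} (\<lambda>x. F (Complex x d))))
         \<le> (A + B) * (d - c)"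
proof -
  define p1 p2 p3 p4 where "p1 = Complex a c" and "p2 = Complex b c"
    and "p3 = Complex b d" and "p4 = Complex a d"
  note p_defs = p1_def p2_def p3_def p4_def
  have segments: "path_image (rectpath p1 p3) =
      closed_segment p1 p2 \<union> (closed_segment p2 p3 \<union> (closed_segment p3 p4 \<union> closed_segment p4 p1))"
    unfolding rectpath_def Let_def p_defs by (simp add: path_image_join)
  have integrable: "F contour_integrable_on linepath p1 p2" "F contour_integrable_on linepath p2 p3"
    "F contour_integrable_on linepath p3 p4" "F contour_integrable_on linepath p4 p1"
    using cont unfolding p1_def[symmetric] p3_def[symmetric] segments
    by (auto intro!: contour_integrable_continuous_linepath elim: continuous_on_subset)
  have bottom: "contour_integral (linepath p1 p2) F = integral {a..b} (\<lambda>x. F (Complex x c))"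
    unfolding p_defs by (rule contour_integral_horizontal_segment[OF ab])
  have "contour_integral (linepath p3 p4) F = - contour_integral (linepath p4 p3) F"
    by (metis contour_integral_reversepath reversepath_linepath valid_path_linepath)
  also have "contour_integral (linepath p4 p3) F = integral {a..b} (\<lambda>x. F (Complex x d))"
    unfolding p_defs by (rule contour_integral_horizontal_segment[OF ab])
  finally have top: "contour_integral (linepath p3 p4) F = - integral {a..b} (\<lambda>x. F (Complex x d))" .
  have "rectpath p1 p3 = linepath p1 p2 +++ linepath p2 p3 +++ linepath p3 p4 +++ linepath p4 p1"
    by (simp add: rectpath_def Let_def p_defs)
  then have "contour_integral (rectpath p1 p3) F =
      contour_integral (linepath p1 p2) F + (contour_integral (linepath p2 p3) F +
      (contour_integral (linepath p3 p4) F + contour_integral (linepath p4 p1) F))"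
    using integrable by (simp add: p_defs)
  then have split: "contour_integral (rectpath p1 p3) F -
        (integral {a..b} (\<lambda>x. F (Complex x c)) - integral {a..b} (\<lambda>x. F (Complex x d))) =
      contour_integral (linepath p4 p1) F + contour_integral (linepath p2 p3) F"
    by (simp add: bottom top)
  have side: "norm (contour_integral (linepath p q) F) \<le> C * (d - c)"
    if "F contour_integrable_on linepath p q" "{p, q} = {Complex r c, Complex r d}"
      "\<And>y. y \<in> {c..d} \<Longrightarrow> norm (F (Complex r y)) \<le> C" for p q r C
  proof -
    have seg: "closed_segment p q = {z. Re z = r \<and> Im z \<in> {c..d}}"
    proof -
      have "closed_segment p q = closed_segment (Complex r c) (Complex r d)"
        using that(2) by (metis closed_segment_commute doubleton_eq_iff)
      then show ?thesis
        using cd by (simp add: closed_segment_same_Re closed_segment_eq_real_ivl)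
    qed
    have "0 \<le> C"
      using order_trans[OF norm_ge_zero that(3)[of c]] cd by simp
    moreover have "norm (F z) \<le> C" if "z \<in> closed_segment p q" for z
      using that \<open>\<And>y. y \<in> {c..d} \<Longrightarrow> norm (F (Complex r y)) \<le> C\<close>[of "Im z"] unfolding seg by auto
    ultimately have "norm (contour_integral (linepath p q) F) \<le> C * norm (q - p)"
      using that(1) by (intro contour_integral_bound_linepath)
    also have "norm (q - p) = d - c"
      using that(2) cd by (auto simp: doubleton_eq_iff cmod_def)
    finally show ?thesis .
  qed
  have "norm (contour_integral (linepath p4 p1) F) \<le> A * (d - c)"
    using integrable left by (intro side[where r = a]) (auto simp: p_defs)
  moreover have "norm (contour_integral (linepath p2 p3) F) \<le> B * (d - c)"
    using integrable right by (intro side[where r = b]) (auto simp: p_defs)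
  ultimately show ?thesis
    unfolding p1_def[symmetric] p3_def[symmetric] split
    by (intro order_trans[OF norm_triangle_ineq]) (simp add: algebra_simps)
qed

section \<open>A kernel with poles at the nodes\<close>

text \<open>
  The value \<open>f z = 0\<close> is possible here, in which case the singularity is removable. The limit that defines
  a simple residue treats both cases alike.
\<close>

lemma residue_over_simple_zero:
  assumes "open S" "z \<in> S" "f holomorphic_on S" "g holomorphic_on S"
    and nz: "\<And>u. u \<in> S - {z} \<Longrightarrow> g u \<noteq> 0"
    and g: "(g has_field_derivative g') (at z)" "g z = 0" "g' \<noteq> 0"
  shows "residue (\<lambda>u. f u / g u) z = f z / g'"
proof (rule residue_simple'[OF assms(1,2)])
  show "(\<lambda>u. f u / g u) holomorphic_on S - {z}"
    using assms(3,4) nz by (intro holomorphic_intros) (auto elim: holomorphic_on_subset)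
  have "((\<lambda>u. f u / ((g u - g z) / (u - z))) \<longlongrightarrow> f z / g') (at z)"
  proof (rule tendsto_divide)
    show "f \<midarrow>z\<rightarrow> f z"
      using assms(1-3) by (metis continuous_on_eq_continuous_at holomorphic_on_imp_continuous_on isCont_def)
    show "((\<lambda>u. (g u - g z) / (u - z)) \<longlongrightarrow> g') (at z)"
      using g(1) by (simp add: has_field_derivative_iff)
  qed (fact g)
  then show "((\<lambda>u. f u / g u * (u - z)) \<longlongrightarrow> f z / g') (at z)"
    using g(2) by simp
qed

text \<open>
  This kernel has a simple pole with residue \<open>h / (2 \<pi> \<i>)\<close> at every node \<open>k h\<close>, so a contour integral of \<open>f\<close>
  times the kernel sums the values of \<open>f\<close> at the enclosed nodes. It is close to \<open>0\<close> far below the real line and to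
  \<open>-1\<close> far above it.
\<close>

definition node_kernel :: "real \<Rightarrow> complex \<Rightarrow> complex" where
  "node_kernel h z = 1 / (exp (2 * pi * \<i> * z / h) - 1)"

lemma exp_node_eq_1_iff:
  assumes "h > 0"
  shows "exp (2 * pi * \<i> * z / complex_of_real h) = 1 \<longleftrightarrow> (\<exists>k::int. z = of_real (of_int k * h))"
  unfolding exp_eq_1 using assms
  by (auto simp: complex_eq_iff Re_divide_of_real Im_divide_of_real field_simps)

lemma norm_node_exponential: "norm (exp (2 * pi * \<i> * Complex x y / complex_of_real h)) = exp (- (2 * pi * y / h))"
  by (simp add: norm_exp_eq_Re Re_divide_of_real)

text \<open>
  Half way between two nodes the exponential is real and negative, so the denominator of the kernel stays
  away from \<open>0\<close> at every height.
\<close>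

lemma norm_node_kernel_between_nodes:
  assumes h: "h > 0" and x: "x = (of_int k + 1/2) * h"
  shows "norm (node_kernel h (Complex x y)) \<le> 1"
proof -
  define r where "r = exp (- (2 * pi * y / h))"
  have "2 * pi * \<i> * Complex x y / complex_of_real h = of_real (- (2 * pi * y / h)) + \<i> * of_real (of_int (2 * k + 1) * pi)"
    using h unfolding x by (simp add: complex_eq_iff field_simps Re_divide_of_real Im_divide_of_real)
  also have "exp \<dots> = of_real r * exp (\<i> * of_real (of_int (2 * k + 1) * pi))"
    by (simp only: exp_add r_def exp_of_real)
  also have "exp (\<i> * complex_of_real (of_int (2 * k + 1) * pi)) = - 1"
  proof -
    have "cis (of_int (2 * k + 1) * pi) = - 1"
      using cos_int_2pin[of k] sin_int_2pin[of k]
      by (simp add: complex_eq_iff algebra_simps cos_add sin_add)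
    then show ?thesis
      by (simp add: cis_conv_exp)
  qed
  finally have "exp (2 * pi * \<i> * Complex x y / complex_of_real h) - 1 = - of_real (r + 1)"
    by simp
  then have "norm (node_kernel h (Complex x y)) = 1 / (r + 1)"
    unfolding node_kernel_def by (simp only: norm_divide norm_one norm_minus_cancel norm_of_real) (simp add: r_def add_pos_pos)
  also have "\<dots> \<le> 1"
    by (simp add: r_def add_pos_pos)
  finally show ?thesis .
qed

lemma norm_node_kernel_below:
  assumes "h > 0" "d > 0"
  shows "norm (node_kernel h (Complex x (- d))) \<le> exp (- (2 * pi * d / h)) / (1 - exp (- (2 * pi * d / h)))"
proof -
  define c where "c = 2 * pi * d / h"
  have c: "c > 0" using assms by (simp add: c_def)
  have "exp c - 1 \<le> norm (exp (2 * pi * \<i> * Complex x (- d) / complex_of_real h) - 1)"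
    using norm_triangle_ineq2[of "exp (2 * pi * \<i> * Complex x (- d) / complex_of_real h)" 1]
    by (simp only: norm_node_exponential norm_one) (simp add: c_def)
  then have "norm (node_kernel h (Complex x (- d))) \<le> 1 / (exp c - 1)"
    unfolding node_kernel_def using c by (simp add: norm_divide divide_simps)
  also have "\<dots> = exp (- c) / (1 - exp (- c))"
    using c by (simp add: exp_minus divide_simps)
  finally show ?thesis by (simp add: c_def)
qed

lemma norm_node_kernel_above:
  assumes "h > 0" "d > 0"
  shows "norm (node_kernel h (Complex x d) + 1) \<le> exp (- (2 * pi * d / h)) / (1 - exp (- (2 * pi * d / h)))"
proof -
  define E where "E = exp (2 * pi * \<i> * Complex x d / complex_of_real h)"
  define q where "q = exp (- (2 * pi * d / h))"
  have q: "q < 1" using assms by (simp add: q_def)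
  have nE: "norm E = q"
    unfolding E_def q_def by (rule norm_node_exponential)
  then have "E \<noteq> 1" using q by auto
  then have "node_kernel h (Complex x d) + 1 = E / (E - 1)"
    unfolding node_kernel_def E_def[symmetric] by (simp add: divide_simps)
  moreover have "1 - q \<le> norm (E - 1)"
    using norm_triangle_ineq2[of 1 E] by (simp add: nE norm_minus_commute)
  ultimately show ?thesis
    using q unfolding q_def[symmetric] by (simp add: norm_divide nE) (simp add: q_def frac_le)
qed

section \<open>The trapezoidal rule for functions holomorphic in a strip\<close>

lemma integral_off_axis_bound:
  fixes F :: "complex \<Rightarrow> complex" and g :: "real \<Rightarrow> real"
  assumes "(\<lambda>x. F (Complex x y)) integrable_on {a..b}" "continuous_on UNIV g" 
    and "\<And>x. norm (F (Complex x y)) \<le> c * g x"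
  shows "norm (integral {a..b} (\<lambda>x. F (Complex x y))) \<le> c * integral {a..b} g"
proof -
  have "norm (integral {a..b} (\<lambda>x. F (Complex x y))) \<le> integral {a..b} (\<lambda>x. c * g x)"
    using assms
    by (intro integral_norm_bound_integral integrable_continuous_interval[of _ _ "\<lambda>x. c * g x"] continuous_intros)
      (auto elim: continuous_on_subset)
  then show ?thesis by simp
qed

text \<open>
  The vertical sides of the rectangle lie half a step beyond the nodes \<open>- N h\<close> and \<open>N h\<close>, so it
  encloses exactly \<open>2 N + 1\<close> of them.
\<close>

lemma contour_integral_node_kernel:
  fixes f :: "complex \<Rightarrow> complex" and h :: real and N :: nat
  defines "R \<equiv> (real N + 1/2) * h"
  assumes d: "0 < d" "d < D" and h: "h > 0"
    and f: "f holomorphic_on {z. \<bar>Im z\<bar> < D}"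
  shows "contour_integral (rectpath (Complex (- R) (- d)) (Complex R d)) (\<lambda>z. f z * node_kernel h z) =
           (\<Sum>k\<in>{- int N..int N}. h * f (of_real (of_int k * h)))"
    and "continuous_on (path_image (rectpath (Complex (- R) (- d)) (Complex R d))) (node_kernel h)"
proof -
  \<comment> \<open>A slightly larger rectangle that contains no further nodes; it is convex, so the winding number vanishes outside.\<close>
  define S where "S = box (Complex (- (real N + 1) * h) (- D)) (Complex ((real N + 1) * h) D)"
  define node where "node k = complex_of_real (of_int k * h)" for k
  define K where "K = {- int N..int N}"
  let ?\<gamma> = "rectpath (Complex (- R) (- d)) (Complex R d)"
  define g where "g = (\<lambda>z. exp (2 * pi * \<i> * z / complex_of_real h) - 1)"
  define F where "F = (\<lambda>z. f z / g z)"
  have F: "f z * node_kernel h z = F z" for z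
    by (simp add: node_kernel_def F_def g_def)
  have R: "0 < R" using h by (simp add: R_def add_nonneg_pos)
  have S: "open S" "convex S" "connected S"
    by (auto simp: S_def convex_connected)
  have fS: "f holomorphic_on S"
    by (rule holomorphic_on_subset[OF f]) (auto simp: S_def in_box_complex_iff)
  have gS: "g holomorphic_on S"
    unfolding g_def by (intro holomorphic_intros) (use h in auto)
  have zeros: "g z = 0 \<longleftrightarrow> z \<in> node ` K" if "z \<in> S" for z
  proof -
    have "k \<in> K" if "node k \<in> S" for k
    proof -
      have "- (real N + 1) * h < of_int k * h" "of_int k * h < (real N + 1) * h"
        using that by (simp_all add: S_def node_def in_box_complex_iff)
      then have "- (real N + 1) < of_int k" "of_int k < real N + 1"
        using h by (simp_all only: mult_less_cancel_right_pos)
      then show ?thesis unfolding K_def by auto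
    qed
    moreover have "g z = 0 \<longleftrightarrow> (\<exists>k. z = node k)"
      using exp_node_eq_1_iff[OF h, of z] by (simp add: g_def node_def)
    ultimately show ?thesis using that by auto
  qed
  have node_box: "node k \<in> box (Complex (- R) (- d)) (Complex R d)" if "k \<in> K" for k
  proof -
    have "- (real N + 1/2) < of_int k" "of_int k < real N + 1/2"
      using that by (auto simp: K_def)
    then have "- (real N + 1/2) * h < of_int k * h" "of_int k * h < (real N + 1/2) * h"
      using h by (simp_all only: mult_less_cancel_right_pos)
    then show ?thesis
      using d by (simp add: node_def in_box_complex_iff R_def algebra_simps)
  qed
  have "R < (real N + 1) * h"
    using h by (simp add: R_def)
  then have box_S: "cbox (Complex (- R) (- d)) (Complex R d) \<subseteq> S"
    using d by (auto simp: S_def in_box_complex_iff in_cbox_complex_iff algebra_simps)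
  have image: "path_image ?\<gamma> = cbox (Complex (- R) (- d)) (Complex R d) - box (Complex (- R) (- d)) (Complex R d)"
    using R d by (intro path_image_rectpath_cbox_minus_box) auto
  have image_sub: "path_image ?\<gamma> \<subseteq> S - node ` K"
    using box_S node_box unfolding image by auto
  have FS: "F holomorphic_on S - node ` K"
    unfolding F_def using fS gS zeros
    by (intro holomorphic_intros) (auto elim: holomorphic_on_subset)
  have residue: "residue F (node k) = f (node k) / (2 * pi * \<i> / h)" if "k \<in> K" for k
  proof -
    have node_S: "node k \<in> S"
      using node_box[OF that] box_S box_subset_cbox by blast
    \<comment> \<open>The other nodes must be removed to isolate the pole at \<open>k h\<close>.\<close>
    define S' where "S' = S - (node ` K - {node k})"
    have "open S'"
      unfolding S'_def K_def using S by (intro open_Diff finite_imp_closed) auto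
    moreover have "g u \<noteq> 0" if "u \<in> S' - {node k}" for u
      using that zeros[of u] by (auto simp: S'_def)
    moreover have "g (node k) = 0"
      using zeros[OF node_S] that by auto
    moreover have "(g has_field_derivative 2 * pi * \<i> / h) (at (node k))"
    proof -
      have "exp (2 * pi * \<i> * node k / complex_of_real h) = 1"
        using exp_node_eq_1_iff[OF h, of "node k"] by (auto simp: node_def)
      then show ?thesis
        unfolding g_def by (auto intro!: derivative_eq_intros simp: h[THEN less_imp_neq, symmetric])
    qed
    moreover have "f holomorphic_on S'" "g holomorphic_on S'"
      using fS gS by (auto simp: S'_def elim: holomorphic_on_subset)
    ultimately show ?thesis
      unfolding F_def using h node_S by (intro residue_over_simple_zero[where S = S']) (auto simp: S'_def)
  qed
  have "contour_integral ?\<gamma> F = 2 * pi * \<i> * (\<Sum>p\<in>node ` K. winding_number ?\<gamma> p * residue F p)"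
  proof (rule Residue_theorem[OF S(1,3) _ FS _ _ image_sub])
    show "\<forall>z. z \<notin> S \<longrightarrow> winding_number ?\<gamma> z = 0"
      using image_sub S by (auto intro!: winding_number_zero_outside[where s = S])
  qed (auto simp: K_def)
  also have "(\<Sum>p\<in>node ` K. winding_number ?\<gamma> p * residue F p) =
      (\<Sum>k\<in>K. winding_number ?\<gamma> (node k) * residue F (node k))"
    using h by (intro sum.reindex_cong[where l = node]) (auto simp: inj_on_def node_def)
  also have "\<dots> = (\<Sum>k\<in>K. f (node k) / (2 * pi * \<i> / h))"
    by (intro sum.cong) (simp_all add: winding_number_rectpath node_box residue)
  also have "2 * pi * \<i> * \<dots> = (\<Sum>k\<in>K. h * f (node k))"
    unfolding sum_distrib_left by (intro sum.cong) (simp_all add: field_simps)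
  finally show "contour_integral ?\<gamma> (\<lambda>z. f z * node_kernel h z) = (\<Sum>k\<in>{- int N..int N}. h * f (of_real (of_int k * h)))"
    unfolding F K_def node_def .
  have "continuous_on (S - node ` K) (node_kernel h)"
    unfolding node_kernel_def g_def[symmetric, THEN fun_cong]
    using zeros holomorphic_on_imp_continuous_on[OF gS]
    by (intro continuous_intros) (auto simp: g_def elim: continuous_on_subset)
  then show "continuous_on (path_image ?\<gamma>) (node_kernel h)"
    using image_sub by (rule continuous_on_subset)
qed

text \<open>
  The contour integral of \<open>f\<close> times the kernel is the trapezoidal sum. On the lower side the kernel has
  modulus at most \<open>q / (1 - q)\<close>. On the upper side, traversed backwards, it is \<open>-1\<close> up to an error of
  the same size, and the main part is the integral of \<open>f\<close> along that side, which Cauchy's theorem moves down to the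
  real line. The majorant \<open>g\<close> bounds what remains; its values at the endpoints bound the vertical sides.
\<close>

lemma trapezoidal_rule_on_strip:
  fixes f :: "complex \<Rightarrow> complex" and g :: "real \<Rightarrow> real" and h :: real and N :: nat
  defines "R \<equiv> (real N + 1/2) * h"
  assumes d: "0 < d" "d < D" and h: "h > 0"
    and f: "f holomorphic_on {z. \<bar>Im z\<bar> < D}"
    and g: "continuous_on UNIV g"
    and fg: "\<And>x y. \<bar>y\<bar> \<le> d \<Longrightarrow> norm (f (Complex x y)) \<le> g x"
    and q: "q = exp (- (2 * pi * d / h))"
  shows "norm ((\<Sum>k\<in>{- int N..int N}. h * f (of_real (of_int k * h))) - integral {- R..R} (\<lambda>x. f (of_real x)))
         \<le> 2 * (q / (1 - q)) * integral {- R..R} g + 3 * d * (g (- R) + g R)"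
proof -
  define F where "F = (\<lambda>z. f z * node_kernel h z)"
  define I where "I G y = integral {- R..R} (\<lambda>x. G (Complex x y))" for G :: "complex \<Rightarrow> complex" and y
  define \<Sigma> where "\<Sigma> = (\<Sum>k\<in>{- int N..int N}. h * f (of_real (of_int k * h)))"
  let ?\<gamma> = "rectpath (Complex (- R) (- d)) (Complex R d)"
  let ?\<gamma>' = "rectpath (Complex (- R) 0) (Complex R d)"
  have R: "R = (of_int (int N) + 1/2) * h" "- R = (of_int (- int N - 1) + 1/2) * h"
    by (simp_all add: R_def algebra_simps)
  have R_pos: "0 < R" using h by (simp add: R_def add_nonneg_pos)
  have g_nonneg: "0 \<le> g x" for x
    using order_trans[OF norm_ge_zero fg[of 0 x]] d by simp
  have f_cont: "continuous_on {z. \<bar>Im z\<bar> < D} f"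
    by (rule holomorphic_on_imp_continuous_on[OF f])
  have f_int: "(\<lambda>x. f (Complex x y)) integrable_on {- R..R}" if "\<bar>y\<bar> \<le> d" for y
    using that d unfolding Complex_eq
    by (intro integrable_continuous_interval continuous_on_compose2[OF f_cont] continuous_intros) auto
  have image: "path_image ?\<gamma> = cbox (Complex (- R) (- d)) (Complex R d) - box (Complex (- R) (- d)) (Complex R d)"
    using R_pos d by (intro path_image_rectpath_cbox_minus_box) auto
  have F_cont: "continuous_on (path_image ?\<gamma>) F"
  proof -
    have "path_image ?\<gamma> \<subseteq> {z. \<bar>Im z\<bar> < D}"
      using d unfolding image by (auto simp: in_cbox_complex_iff)
    then show ?thesis
      unfolding F_def using contour_integral_node_kernel(2)[OF d h f, of N]
      by (intro continuous_on_mult continuous_on_subset[OF f_cont]) (auto simp: R_def)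
  qed
  have F_int: "(\<lambda>x. F (Complex x y)) integrable_on {- R..R}" if "\<bar>y\<bar> = d" for y
  proof (intro integrable_continuous_interval continuous_on_compose2[OF F_cont])
    show "continuous_on {- R..R} (\<lambda>x. Complex x y)"
      unfolding Complex_eq by (intro continuous_intros)
    show "(\<lambda>x. Complex x y) ` {- R..R} \<subseteq> path_image ?\<gamma>"
      using that R_pos d unfolding image by (auto simp: in_cbox_complex_iff in_box_complex_iff)
  qed

  \<comment> \<open>The residue theorem, up to the vertical sides of the rectangle.\<close>
  have "norm (F (Complex s y)) \<le> g s" if "y \<in> {- d..d}" "s \<in> {- R, R}" for s y
  proof -
    have "norm (node_kernel h (Complex s y)) \<le> 1"
      using that(2) R norm_node_kernel_between_nodes[OF h] by blast
    then have "norm (f (Complex s y)) * norm (node_kernel h (Complex s y)) \<le> g s * 1"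
      using fg[of y s] that(1) g_nonneg by (intro mult_mono) auto
    then show ?thesis by (simp add: F_def norm_mult)
  qed
  then have "norm (contour_integral ?\<gamma> F - (I F (- d) - I F d)) \<le> (g (- R) + g R) * (d - - d)"
    unfolding I_def using R_pos d F_cont by (intro contour_integral_rectpath_approx) auto
  also have "contour_integral ?\<gamma> F = \<Sigma>"
    unfolding F_def R_def \<Sigma>_def by (rule contour_integral_node_kernel(1)[OF d h f])
  finally have residues: "norm (\<Sigma> - (I F (- d) - I F d)) \<le> (g (- R) + g R) * (2 * d)"
    by simp

  \<comment> \<open>Cauchy's theorem in the upper half of the rectangle, again up to vertical sides.\<close>
  have image': "path_image ?\<gamma>' \<subseteq> {z. \<bar>Im z\<bar> < D}"
    using path_image_rectpath_subset_cbox[of "Complex (- R) 0" "Complex R d"] R_pos d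
    by (auto simp: in_cbox_complex_iff)
  have "norm (contour_integral ?\<gamma>' f - (I f 0 - I f d)) \<le> (g (- R) + g R) * (d - 0)"
    unfolding I_def using R_pos d fg
    by (intro contour_integral_rectpath_approx continuous_on_subset[OF f_cont image']) auto
  also have "contour_integral ?\<gamma>' f = 0"
  proof (rule contour_integral_unique, rule Cauchy_theorem_convex_simple[OF f _ _ image'])
    have "{z. \<bar>Im z\<bar> < D} = {z. Im z < D} \<inter> {z. Im z > - D}" by auto
    then show "convex {z. \<bar>Im z\<bar> < D}"
      by (simp add: convex_Int convex_halfspace_Im_lt convex_halfspace_Im_gt)
  qed auto
  finally have cauchy: "norm (I f d - I f 0) \<le> (g (- R) + g R) * d"
    by simp

  \<comment> \<open>On the lower side the kernel is small, on the upper side it is close to \<open>-1\<close>.\<close>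
  have lower: "norm (I F (- d)) \<le> q / (1 - q) * integral {- R..R} g"
    unfolding I_def
  proof (rule integral_off_axis_bound[OF F_int g])
    show "norm (F (Complex x (- d))) \<le> q / (1 - q) * g x" for x
      using mult_mono[OF fg[of "- d" x] norm_node_kernel_below[OF h d(1), of x, folded q] g_nonneg norm_ge_zero] d
      by (simp add: F_def norm_mult mult.commute)
  qed (use d in simp)
  have upper: "norm (I F d + I f d) \<le> q / (1 - q) * integral {- R..R} g"
  proof -
    have "I F d + I f d = I (\<lambda>z. F z + f z) d"
      unfolding I_def using F_int[of d] f_int[of d] d by (simp add: integral_add)
    moreover have "norm (I (\<lambda>z. F z + f z) d) \<le> q / (1 - q) * integral {- R..R} g"
      unfolding I_def
    proof (rule integral_off_axis_bound[OF integrable_add[OF F_int f_int] g])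
      show "norm (F (Complex x d) + f (Complex x d)) \<le> q / (1 - q) * g x" for x
      proof -
        have "F (Complex x d) + f (Complex x d) = f (Complex x d) * (node_kernel h (Complex x d) + 1)"
          by (simp add: F_def algebra_simps)
        then show ?thesis
          using mult_mono[OF fg[of d x] norm_node_kernel_above[OF h d(1), of x, folded q] g_nonneg norm_ge_zero] d
          by (simp add: norm_mult mult.commute)
      qed
    qed (use d in simp_all)
    ultimately show ?thesis by simp
  qed
  have "norm (u + v + w - x) \<le> A + B + C + C'"
    if "norm u \<le> A" "norm v \<le> B" "norm w \<le> C" "norm x \<le> C'" for u v w x :: complex and A B C C' :: real
    using that by (intro norm_triangle_mono order_trans[OF norm_triangle_ineq4 add_mono])
  from this[OF residues cauchy lower upper]
  have "norm (\<Sigma> - I f 0) \<le> (g (- R) + g R) * (2 * d) + (g (- R) + g R) * d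
      + q / (1 - q) * integral {- R..R} g + q / (1 - q) * integral {- R..R} g"
    by (simp add: algebra_simps)
  also have "\<dots> = 2 * (q / (1 - q)) * integral {- R..R} g + 3 * d * (g (- R) + g R)"
    by (simp add: algebra_simps)
  also have "I f 0 = integral {- R..R} (\<lambda>x. f (of_real x))"
    by (simp add: I_def complex_of_real_def)
  finally show ?thesis
    unfolding \<Sigma>_def .
qed

section \<open>The integrand on the real line\<close>

text \<open>
  This links the derivative of \<open>ln (1 + exp x)\<close> with the function itself. It is what makes the
  perturbation off the real axis relative rather than absolute, also for \<open>x\<close> near \<open>-\<infinity>\<close>.
\<close>

lemma logistic_le_ln_one_plus_exp: "1 / (1 + exp (- x)) \<le> ln (1 + exp (x::real))"
proof -
  have pos: "1 + exp x > 0" by (simp add: add_pos_pos)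
  have "ln (inverse (1 + exp x)) \<le> inverse (1 + exp x) - 1"
    using pos by (intro ln_le_minus_one) simp
  then have "1 - inverse (1 + exp x) \<le> ln (1 + exp x)"
    using pos by (simp add: ln_inverse)
  also have "1 - inverse (1 + exp x) = 1 / (1 + exp (- x))"
    using pos by (simp add: exp_minus divide_simps)
  finally show ?thesis .
qed

lemma le_ln_one_plus_exp: "x \<le> ln (1 + exp (x::real))"
  by (metis add_pos_pos exp_gt_zero le_add_same_cancel2 ln_exp ln_le_cancel_iff zero_less_one less_imp_le)

lemma ln_one_plus_exp_pos: "0 < ln (1 + exp (x::real))"
  by (intro ln_gt_zero) simp

lemma has_real_derivative_ln_one_plus_exp:
  "((\<lambda>x. ln (1 + exp x)) has_real_derivative 1 / (1 + exp (- x))) (at x within S)"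
proof -
  have "1 + exp x > 0" by (simp add: add_pos_pos)
  then show ?thesis
    by (auto intro!: derivative_eq_intros simp: exp_minus divide_simps)
qed

lemma powr_minus_half: "t > 0 \<Longrightarrow> t powr (-1/2) = 1 / sqrt t"
  using powr_minus_divide[of t "1/2"] by (simp add: powr_half_sqrt)

lemma w_eq: "w x = 2 / sqrt pi * (1 / (1 + exp (- x)))"
  unfolding w_def powr_minus_half[OF pi_gt_zero] by (simp add: field_simps)

lemma w_bounds: "0 < w x" "w x \<le> 2 / sqrt pi" "w x \<le> 2 / sqrt pi * exp x"
proof -
  have "1 + exp (- x) > 0" by (simp add: add_pos_pos)
  then show "0 < w x" "w x \<le> 2 / sqrt pi"
    by (simp_all add: w_eq divide_simps)
  have "1 / (1 + exp (- x)) \<le> exp x"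
    by (simp add: exp_minus divide_simps add_pos_pos)
  then show "w x \<le> 2 / sqrt pi * exp x"
    unfolding w_eq by (intro mult_left_mono) simp_all
qed

definition integrand :: "real \<Rightarrow> real \<Rightarrow> real" where
  "integrand t x = w x * exp (- alpha x * t)"

lemma integrand_pos: "0 < integrand t x"
  by (simp add: integrand_def w_bounds)

lemma continuous_on_integrand: "continuous_on A (integrand t)"
proof -
  have "1 + exp x \<noteq> 0" for x :: real
    using exp_gt_zero[of x] by linarith
  then show ?thesis
    unfolding integrand_def[abs_def] w_def alpha_def by (intro continuous_intros) auto
qed


section \<open>Reduction to the Gaussian integral\<close>

lemma gaussian_has_integral_Ioi:
  assumes t: "t > 0"
  shows "((\<lambda>u. exp (- (t * u\<^sup>2))) has_integral sqrt pi / (2 * sqrt t)) {0<..}"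
proof -
  have "has_bochner_integral lborel (\<lambda>x. indicator {0..} (0 + sqrt t * x) *\<^sub>R exp (- (0 + sqrt t * x)\<^sup>2))
      ((sqrt pi / 2) /\<^sub>R \<bar>sqrt t\<bar>)"
    using gaussian_moment_0 t by (subst lborel_has_bochner_integral_real_affine_iff[symmetric]) auto
  also have "(\<lambda>x. indicator {0..} (0 + sqrt t * x) *\<^sub>R exp (- (0 + sqrt t * x)\<^sup>2)) =
      (\<lambda>x. if x \<in> {0..} then exp (- (t * x\<^sup>2)) else 0)"
    using t by (auto simp: fun_eq_iff indicator_def power_mult_distrib zero_le_mult_iff)
  also have "(sqrt pi / 2) /\<^sub>R \<bar>sqrt t\<bar> = sqrt pi / (2 * sqrt t)"
    using t by (simp add: field_simps)
  finally have "((\<lambda>x. if x \<in> {0..} then exp (- (t * x\<^sup>2)) else 0) has_integral sqrt pi / (2 * sqrt t)) UNIV"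
    using has_integral_integral_lborel[of "\<lambda>x. if x \<in> {0..} then exp (- (t * x\<^sup>2)) else 0"]
    unfolding has_bochner_integral_iff by simp
  then have "((\<lambda>x. exp (- (t * x\<^sup>2))) has_integral sqrt pi / (2 * sqrt t)) {0..}"
    by (simp only: has_integral_restrict_UNIV)
  then show ?thesis
  proof (rule has_integral_spike_set_eq[THEN iffD1, rotated 2])
    show "negligible {x \<in> {0..} - {0<..}. exp (- (t * x\<^sup>2)) \<noteq> 0}"
      by (rule negligible_subset[OF negligible_sing[of 0]]) auto
    show "negligible {x \<in> {0<..} - {0..}. exp (- (t * x\<^sup>2)) \<noteq> (0::real)}"
      by (rule negligible_subset[OF negligible_sing[of 0]]) auto
  qed
qed

lemma integral_integrand_substitution:
  assumes "a \<le> b"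
  shows "integral {a..b} (integrand t) = 2 / sqrt pi * integral {ln (1 + exp a)..ln (1 + exp b)} (\<lambda>u. exp (- (t * u\<^sup>2)))"
proof -
  let ?s = "\<lambda>x::real. ln (1 + exp x)"
  have mono: "?s x \<le> ?s y" if "x \<le> y" for x y
    using that by (simp add: add_pos_pos)
  have "((\<lambda>x. (1 / (1 + exp (- x))) *\<^sub>R exp (- (t * (?s x)\<^sup>2))) has_integral
      integral {?s a..?s b} (\<lambda>u. exp (- (t * u\<^sup>2)))) {a..b}"
  proof (rule has_integral_substitution[where c = "?s a" and d = "?s b"])
    show "?s ` {a..b} \<subseteq> {?s a..?s b}"
      using mono by auto
    show "continuous_on {?s a..?s b} (\<lambda>u. exp (- (t * u\<^sup>2)))"
      by (intro continuous_intros)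
    show "(?s has_field_derivative 1 / (1 + exp (- x))) (at x within {a..b})" for x
      by (rule has_real_derivative_ln_one_plus_exp)
  qed (use assms mono[OF assms] in simp_all)
  from has_integral_mult_right[OF this, of "2 / sqrt pi"]
  show ?thesis
    by (intro integral_unique) (simp add: integrand_def[abs_def] w_eq alpha_def mult.assoc mult.commute[of t])
qed

lemma integral_integrand_le:
  assumes t: "t > 0"
  shows "integral {a..b} (integrand t) \<le> 1 / sqrt t"
proof (cases "a \<le> b")
  case True
  let ?I = "{ln (1 + exp a)..ln (1 + exp b)}"
  have "integral ?I (\<lambda>u. exp (- (t * u\<^sup>2))) \<le> integral {0<..} (\<lambda>u. exp (- (t * u\<^sup>2)))"
  proof (rule integral_subset_le)
    show "?I \<subseteq> {0<..}"
      using ln_one_plus_exp_pos[of a] by auto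
    show "(\<lambda>u. exp (- (t * u\<^sup>2))) integrable_on ?I"
      by (intro integrable_continuous_interval continuous_intros)
    show "(\<lambda>u. exp (- (t * u\<^sup>2))) integrable_on {0<..}"
      using gaussian_has_integral_Ioi[OF t] by blast
  qed simp
  also have "\<dots> = sqrt pi / (2 * sqrt t)"
    by (rule integral_unique[OF gaussian_has_integral_Ioi[OF t]])
  finally have "2 / sqrt pi * integral ?I (\<lambda>u. exp (- (t * u\<^sup>2))) \<le> 2 / sqrt pi * (sqrt pi / (2 * sqrt t))"
    by (intro mult_left_mono) auto
  then show ?thesis
    by (simp add: integral_integrand_substitution[OF True])
next
  case False
  then show ?thesis using t by simp
qed

text \<open>
  As \<open>R n\<close> grows, the image \<open>[ln (1 + exp (- R n)), ln (1 + exp (R n))]\<close> exhausts the open half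
  line, and dominated convergence gives the full Gaussian integral.
\<close>

lemma integral_integrand_tendsto:
  assumes t: "t > 0" and R: "filterlim R at_top sequentially"
  shows "(\<lambda>n. integral {- R n..R n} (integrand t)) \<longlonglongrightarrow> 1 / sqrt t"
proof -
  let ?s = "\<lambda>x::real. ln (1 + exp x)"
  let ?e = "\<lambda>u::real. exp (- (t * u\<^sup>2))"
  let ?I = "\<lambda>n. {?s (- R n)..?s (R n)}"
  have s_bot: "(\<lambda>n. ?s (- R n)) \<longlonglongrightarrow> 0"
  proof -
    have "((\<lambda>x. ?s (- x)) \<longlongrightarrow> 0) at_top" by real_asymp
    then show ?thesis using R by (rule filterlim_compose)
  qed
  have s_top: "filterlim (\<lambda>n. ?s (R n)) at_top sequentially"
  proof -
    have "filterlim ?s at_top at_top" by real_asymp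
    then show ?thesis using R by (rule filterlim_compose)
  qed
  have sub: "?I n \<subseteq> {0<..}" for n
    using ln_one_plus_exp_pos[of "- R n"] by auto
  have "(\<lambda>n. integral {0<..} (\<lambda>u. if u \<in> ?I n then ?e u else 0)) \<longlonglongrightarrow> integral {0<..} ?e"
  proof (rule dominated_convergence(2))
    show "(\<lambda>u. if u \<in> ?I n then ?e u else 0) integrable_on {0<..}" for n
      unfolding integrable_restrict_Int Int_absorb2[OF sub]
      by (intro integrable_continuous_interval continuous_intros)
    show "?e integrable_on {0<..}"
      using gaussian_has_integral_Ioi[OF t] by blast
    show "norm (if u \<in> ?I n then ?e u else 0) \<le> ?e u" for n u
      by simp
    show "(\<lambda>n. if u \<in> ?I n then ?e u else 0) \<longlonglongrightarrow> ?e u" if "u \<in> {0<..}" for u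
    proof (rule tendsto_eventually)
      have "eventually (\<lambda>n. ?s (- R n) < u) sequentially"
        using order_tendstoD(2)[OF s_bot] that by simp
      moreover have "eventually (\<lambda>n. u \<le> ?s (R n)) sequentially"
        using s_top by (simp add: filterlim_at_top)
      ultimately show "eventually (\<lambda>n. (if u \<in> ?I n then ?e u else 0) = ?e u) sequentially"
        by eventually_elim simp
    qed
  qed
  moreover have "integral {0<..} (\<lambda>u. if u \<in> ?I n then ?e u else 0) = integral (?I n) ?e" for n
    using sub[of n] unfolding integral_restrict_Int by (simp only: Int_absorb2)
  ultimately have "(\<lambda>n. integral (?I n) ?e) \<longlonglongrightarrow> sqrt pi / (2 * sqrt t)"
    unfolding integral_unique[OF gaussian_has_integral_Ioi[OF t]] by simp
  then have "(\<lambda>n. 2 / sqrt pi * integral (?I n) ?e) \<longlonglongrightarrow> 2 / sqrt pi * (sqrt pi / (2 * sqrt t))"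
    by (rule tendsto_mult_left)
  also have "2 / sqrt pi * (sqrt pi / (2 * sqrt t)) = 1 / sqrt t"
    by simp
  finally have lim: "(\<lambda>n. 2 / sqrt pi * integral (?I n) ?e) \<longlonglongrightarrow> 1 / sqrt t" .
  have "eventually (\<lambda>n. 0 \<le> R n) sequentially"
    using R unfolding filterlim_at_top by blast
  then have "eventually (\<lambda>n. 2 / sqrt pi * integral (?I n) ?e = integral {- R n..R n} (integrand t)) sequentially"
  proof (rule eventually_mono)
    show "2 / sqrt pi * integral (?I n) ?e = integral {- R n..R n} (integrand t)" if "0 \<le> R n" for n
      using that by (subst integral_integrand_substitution) simp_all
  qed
  with lim show ?thesis
    by (rule Lim_transform_eventually)
qed

lemma integrand_tendsto_0:
  assumes t: "t > 0"
  shows "((\<lambda>x. integrand t (- x)) \<longlongrightarrow> 0) at_top" "(integrand t \<longlongrightarrow> 0) at_top"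
proof -
  have squeeze: "(f \<longlongrightarrow> 0) at_top"
    if "\<And>x. 0 \<le> f x" "eventually (\<lambda>x. f x \<le> g x) at_top" "(g \<longlongrightarrow> 0) at_top" for f g :: "real \<Rightarrow> real"
    using that(1) by (intro tendsto_sandwich[OF _ that(2) tendsto_const that(3)]) simp
  show "((\<lambda>x. integrand t (- x)) \<longlongrightarrow> 0) at_top"
  proof (rule squeeze)
    show "((\<lambda>x. 2 / sqrt pi * exp (- x)) \<longlongrightarrow> 0) at_top"
      by real_asymp
    have "integrand t (- x) \<le> 2 / sqrt pi * exp (- x) * 1" for x
      unfolding integrand_def
      by (rule mult_mono[OF w_bounds(3)]) (use t in \<open>simp_all add: alpha_def\<close>)
    then show "eventually (\<lambda>x. integrand t (- x) \<le> 2 / sqrt pi * exp (- x)) at_top"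
      by simp
  qed (simp add: less_imp_le[OF integrand_pos])
  show "(integrand t \<longlongrightarrow> 0) at_top"
  proof (rule squeeze)
    show "((\<lambda>x. 2 / sqrt pi * exp (- (x\<^sup>2 * t))) \<longlongrightarrow> 0) at_top"
      using t by real_asymp
    show "eventually (\<lambda>x. integrand t x \<le> 2 / sqrt pi * exp (- (x\<^sup>2 * t))) at_top"
      using eventually_ge_at_top[of 0]
    proof eventually_elim
      case (elim x)
      then have "x\<^sup>2 \<le> alpha x"
        unfolding alpha_def using le_ln_one_plus_exp by (intro power_mono)
      then show ?case
        unfolding integrand_def
        by (intro mult_mono[OF w_bounds(2)]) (use t in \<open>simp_all add: mult_right_mono\<close>)
    qed
  qed (simp add: less_imp_le[OF integrand_pos])
qed

section \<open>The integrand in a strip\<close>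

text \<open>
  For \<open>\<bar>y\<bar> \<le> \<pi>/2\<close> the number \<open>exp (- z)\<close> has nonnegative real part, so with \<open>a = exp (- x)\<close> one has
  \<open>\<bar>1 + exp (- z)\<bar>\<^sup>2 \<ge> 1 + a\<^sup>2 \<ge> (1 + a)\<^sup>2 / 2\<close>.
\<close>

lemma norm_logistic_le:
  assumes "\<bar>y\<bar> \<le> pi / 2"
  shows "norm (1 / (1 + exp (- Complex x y))) \<le> sqrt 2 * (1 / (1 + exp (- x)))"
proof -
  define a where "a = exp (- x)"
  have a: "a > 0" by (simp add: a_def)
  have "0 \<le> cos y"
    using assms by (intro cos_ge_zero) auto
  moreover have "(norm (1 + exp (- Complex x y)))\<^sup>2 = (1 + a * cos y)\<^sup>2 + (a * sin y)\<^sup>2"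
    by (simp add: cmod_power2 a_def Re_exp Im_exp)
  moreover have "(1 + a * cos y)\<^sup>2 + (a * sin y)\<^sup>2 = 1 + 2 * (a * cos y) + a\<^sup>2"
    by (simp add: power2_sum power_mult_distrib sin_squared_eq algebra_simps)
  moreover have "(1 + a)\<^sup>2 \<le> 2 * (1 + a\<^sup>2)"
    using zero_le_power2[of "1 - a"] by (simp add: power2_sum power2_diff)
  ultimately have "(1 + a)\<^sup>2 \<le> (sqrt 2 * norm (1 + exp (- Complex x y)))\<^sup>2"
    using a by (simp add: power_mult_distrib) (smt (verit) mult_nonneg_nonneg)
  then have "1 + a \<le> sqrt 2 * norm (1 + exp (- Complex x y))"
    by (rule power2_le_imp_le) simp
  moreover from this have "norm (1 + exp (- Complex x y)) > 0"
    using a by (smt (verit) mult_nonneg_nonpos norm_ge_zero real_sqrt_ge_zero)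
  ultimately show ?thesis
    using a unfolding a_def[symmetric] by (simp add: norm_divide divide_simps add_pos_pos)
qed

lemma one_plus_exp_notin_nonpos_Reals:
  assumes "\<bar>Im z\<bar> < pi / 2"
  shows "1 + exp z \<notin> \<real>\<^sub>\<le>\<^sub>0" "1 + exp z \<noteq> 0"
proof -
  have "Re (1 + exp z) > 0"
    using assms by (simp add: Re_exp add_pos_pos cos_gt_zero_pi abs_less_iff)
  then show "1 + exp z \<notin> \<real>\<^sub>\<le>\<^sub>0" "1 + exp z \<noteq> 0"
    by (auto simp: complex_nonpos_Reals_iff simp del: plus_complex.sel)
qed

lemma has_field_derivative_Ln_one_plus_exp:
  assumes "\<bar>Im z\<bar> < pi / 2"
  shows "((\<lambda>z. Ln (1 + exp z)) has_field_derivative 1 / (1 + exp (- z))) (at z within S)"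
  using one_plus_exp_notin_nonpos_Reals[OF assms]
  by (auto intro!: derivative_eq_intros simp: exp_minus divide_simps add.commute)

text \<open>
  Moving up from the real axis by at most \<open>\<pi>/10\<close> changes \<open>Ln (1 + exp z)\<close> by at most \<open>sqrt 2 \<pi>/10\<close> times
  the logistic function at \<open>x\<close>, hence by a fixed fraction of \<open>ln (1 + exp x)\<close>. That fraction has to be
  below \<open>1/2\<close> in the next lemma. The height cannot be lowered: with \<open>d = \<pi>/10\<close> the exponent
  \<open>2 \<pi> d / h\<close> is just large enough for the factor \<open>\<delta>\<close> to appear to the first power.
\<close>

lemma Ln_one_plus_exp_near_real_axis:
  assumes "\<bar>y\<bar> \<le> pi / 10"
  shows "norm (Ln (1 + exp (Complex x y)) - of_real (ln (1 + exp x))) \<le> 15/32 * ln (1 + exp x)"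
proof -
  define S where "S = {z. Re z = x \<and> \<bar>Im z\<bar> \<le> pi / 10}"
  have S: "S = {z. Re z \<le> x} \<inter> {z. Re z \<ge> x} \<inter> {z. Im z \<le> pi / 10} \<inter> {z. Im z \<ge> - (pi / 10)}"
    by (auto simp: S_def)
  have "convex S"
    unfolding S by (intro convex_Int convex_halfspace_Im_le convex_halfspace_Im_ge
      convex_halfspace_Re_le convex_halfspace_Re_ge)
  then have "norm (Ln (1 + exp (Complex x y)) - Ln (1 + exp (Complex x 0)))
      \<le> sqrt 2 * (1 / (1 + exp (- x))) * norm (Complex x y - Complex x 0)"
  proof (rule field_differentiable_bound)
    fix z assume z: "z \<in> S"
    show "((\<lambda>z. Ln (1 + exp z)) has_field_derivative 1 / (1 + exp (- z))) (at z within S)"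
    proof (rule has_field_derivative_Ln_one_plus_exp)
      show "\<bar>Im z\<bar> < pi / 2"
        using z pi_gt_zero unfolding S_def mem_Collect_eq by linarith
    qed
    show "norm (1 / (1 + exp (- z))) \<le> sqrt 2 * (1 / (1 + exp (- x)))"
    proof -
      have "z = Complex x (Im z)" "\<bar>Im z\<bar> \<le> pi / 2"
        using z pi_gt_zero unfolding S_def mem_Collect_eq by (simp add: complex_eq_iff, linarith)
      then show ?thesis
        by (metis norm_logistic_le)
    qed
  qed (use assms in \<open>auto simp: S_def\<close>)
  also have "norm (Complex x y - Complex x 0) = \<bar>y\<bar>"
    by (simp add: cmod_def)
  also have "sqrt 2 * (1 / (1 + exp (- x))) * \<bar>y\<bar> \<le> (sqrt 2 * \<bar>y\<bar>) * ln (1 + exp x)"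
    using mult_left_mono[OF logistic_le_ln_one_plus_exp[of x], of "sqrt 2 * \<bar>y\<bar>"] by (simp add: mult_ac)
  also have "\<dots> \<le> 15/32 * ln (1 + exp x)"
  proof (intro mult_right_mono)
    have "sqrt 2 \<le> sqrt ((71/50)\<^sup>2)"
      by (intro real_sqrt_le_mono) (simp add: power2_eq_square)
    then have "sqrt 2 \<le> 71/50" by simp
    moreover have "\<bar>y\<bar> \<le> 33/100"
      using assms pi_less_4 pi_approx by simp
    ultimately have "sqrt 2 * \<bar>y\<bar> \<le> 71/50 * (33/100)"
      by (intro mult_mono) auto
    then show "sqrt 2 * \<bar>y\<bar> \<le> 15/32" by simp
  qed (use ln_one_plus_exp_pos[of x] in simp)
  also have "Ln (1 + exp (Complex x 0)) = of_real (ln (1 + exp x))"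
  proof -
    have "1 + exp (Complex x 0) = of_real (1 + exp x)"
      by (simp add: exp_of_real flip: complex_of_real_def)
    then show ?thesis
      by (metis Ln_of_real add_pos_pos exp_gt_zero zero_less_one)
  qed
  finally show ?thesis .
qed

text \<open>
  If \<open>\<bar>\<zeta> - u\<bar> \<le> r u\<close>, then \<open>Re \<zeta> \<ge> (1 - r) u\<close> and \<open>\<bar>Im \<zeta>\<bar> \<le> r u\<close>, so
  \<open>Re (\<zeta>\<^sup>2) \<ge> ((1 - r)\<^sup>2 - r\<^sup>2) u\<^sup>2 = (1 - 2 r) u\<^sup>2\<close>. The value \<open>r = 15/32\<close> is chosen to exceed \<open>sqrt 2 \<pi>/10\<close> and to make
  \<open>1 - 2 r\<close> the square of a rational, since \<open>1 / sqrt (1 - 2 r)\<close> enters the final error bound.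
\<close>

lemma Re_power2_ge:
  fixes \<zeta> :: complex
  assumes "norm (\<zeta> - of_real u) \<le> 15/32 * u"
  shows "u\<^sup>2 / 16 \<le> Re (\<zeta>\<^sup>2)"
proof -
  define e where "e = \<zeta> - of_real u"
  have u: "0 \<le> u" using order_trans[OF norm_ge_zero assms] by simp
  have e: "norm e \<le> 15/32 * u" using assms by (simp add: e_def)
  have "u + Re e \<ge> 17/32 * u"
    using e abs_Re_le_cmod[of e] by linarith
  then have "(17/32 * u)\<^sup>2 \<le> (u + Re e)\<^sup>2"
    using u by (intro power_mono) auto
  moreover have "\<bar>Im e\<bar>\<^sup>2 \<le> (15/32 * u)\<^sup>2"
    using e abs_Im_le_cmod[of e] by (intro power_mono) auto
  moreover have "Re (\<zeta>\<^sup>2) = (u + Re e)\<^sup>2 - (Im e)\<^sup>2"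
    by (simp add: e_def Re_power2)
  ultimately show ?thesis
    by (simp add: power_mult_distrib power_divide)
qed

definition complex_integrand :: "real \<Rightarrow> complex \<Rightarrow> complex" where
  "complex_integrand t z = of_real (2 / sqrt pi) * (1 / (1 + exp (- z))) * exp (- ((Ln (1 + exp z))\<^sup>2 * of_real t))"

lemma complex_integrand_of_real: "complex_integrand t (of_real x) = of_real (integrand t x)"
proof -
  have "Ln (1 + exp (complex_of_real x)) = of_real (ln (1 + exp x))"
    by (metis Ln_of_real add_pos_pos exp_gt_zero exp_of_real of_real_1 of_real_add zero_less_one)
  then show ?thesis
    by (simp add: complex_integrand_def integrand_def w_eq alpha_def flip: exp_of_real)
qed

lemma holomorphic_complex_integrand: "complex_integrand t holomorphic_on {z. \<bar>Im z\<bar> < pi / 2}"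
proof -
  have "1 + exp (- z) \<noteq> 0" if "\<bar>Im z\<bar> < pi / 2" for z
    using one_plus_exp_notin_nonpos_Reals(2)[of "- z"] that by simp
  then show ?thesis
    unfolding complex_integrand_def using one_plus_exp_notin_nonpos_Reals(1)
    by (intro holomorphic_intros) auto
qed

text \<open>
  The bound is again an integrand of the original family, so its integral over the real line is known.
\<close>

lemma norm_complex_integrand_le:
  assumes y: "\<bar>y\<bar> \<le> pi / 10" and t: "t \<ge> 0"
  shows "norm (complex_integrand t (Complex x y)) \<le> sqrt 2 * integrand (t / 16) x"
proof -
  let ?z = "Complex x y"
  have "alpha x / 16 \<le> Re ((Ln (1 + exp ?z))\<^sup>2)"
    unfolding alpha_def by (rule Re_power2_ge[OF Ln_one_plus_exp_near_real_axis[OF y]])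
  from mult_right_mono[OF this t]
  have "norm (exp (- ((Ln (1 + exp ?z))\<^sup>2 * of_real t))) \<le> exp (- alpha x * (t / 16))"
    by (simp add: norm_exp_eq_Re)
  moreover have "norm (of_real (2 / sqrt pi) * (1 / (1 + exp (- ?z)))) \<le> 2 / sqrt pi * (sqrt 2 * (1 / (1 + exp (- x))))"
    unfolding norm_mult using y by (intro mult_mono norm_logistic_le) (auto simp: norm_divide)
  ultimately have "norm (complex_integrand t ?z) \<le>
      2 / sqrt pi * (sqrt 2 * (1 / (1 + exp (- x)))) * exp (- alpha x * (t / 16))"
    unfolding complex_integrand_def norm_mult[of _ "exp _"]
    by (intro mult_mono) (auto simp: add_nonneg_nonneg)
  then show ?thesis
    by (simp add: integrand_def w_eq mult_ac)
qed

section \<open>Truncation errors\<close>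

text \<open>
  The telescoping identity \<open>(\<Sum>j=1..M. exp (- c j)) (exp c - 1) = 1 - exp (- c M)\<close> and \<open>exp c - 1 \<ge> c\<close> give a bound
  in which the step size cancels.
\<close>

lemma sum_exp_tail_le:
  assumes "c > 0"
  shows "(\<Sum>j=1..M. exp (- (c * real j))) \<le> 1 / c"
proof -
  have "(\<Sum>j=1..M. exp (- (c * real j))) * (exp c - 1) = 1 - exp (- (c * real M))"
  proof (induction M)
    case (Suc M)
    have "exp (- (c * real (Suc M))) * exp c = exp (- (c * real M))"
      by (simp add: algebra_simps flip: exp_add)
    then show ?case
      using Suc by (simp add: algebra_simps)
  qed simp
  also have "\<dots> \<le> 1" by simp
  finally have "(\<Sum>j=1..M. exp (- (c * real j))) * (exp c - 1) \<le> 1" .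
  moreover have "c \<le> exp c - 1"
    using exp_ge_add_one_self[of c] by linarith
  ultimately have "(\<Sum>j=1..M. exp (- (c * real j))) * c \<le> 1"
    by (smt (verit) mult_left_mono sum_nonneg exp_ge_zero)
  then show ?thesis
    using assms by (simp add: pos_le_divide_eq)
qed

lemma sum_greaterThanAtMost_int_shift:
  fixes f :: "int \<Rightarrow> 'a :: comm_monoid_add"
  shows "sum f {a<..b} = (\<Sum>j=1..nat (b - a). f (a + int j))"
  by (rule sum.reindex_bij_witness[where i = "\<lambda>j. a + int j" and j = "\<lambda>k. nat (k - a)"]) auto

definition trapezoid_term :: "real \<Rightarrow> real \<Rightarrow> int \<Rightarrow> real" where
  "trapezoid_term h t k = h * integrand t (of_int k * h)"

lemma trapezoid_term_nonneg: "h > 0 \<Longrightarrow> 0 \<le> trapezoid_term h t k"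
  by (simp add: trapezoid_term_def less_imp_le[OF integrand_pos])

lemma phi_eq_sum: "phi \<delta> h n t = sum (trapezoid_term h t) {- int n..n_plus \<delta> h}"
  by (simp add: phi_def trapezoid_term_def integrand_def mult.assoc)

lemma n_plus_times_step:
  assumes "h > 0"
  shows "0 < n_plus \<delta> h" "4 / sqrt pi \<le> of_int (n_plus \<delta> h) * h" "sqrt \<bar>ln (\<delta>/2)\<bar> \<le> of_int (n_plus \<delta> h) * h"
proof -
  define m where "m = max (4 / sqrt pi) (sqrt \<bar>ln (\<delta>/2)\<bar>)"
  have m: "m > 0" by (simp add: m_def less_max_iff_disj)
  have n: "n_plus \<delta> h = \<lceil>inverse h * m\<rceil>"
    by (simp only: n_plus_def m_def powr_minus_half[OF pi_gt_zero] times_divide_eq_right mult_1_right)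
  have "inverse h * m \<le> of_int (n_plus \<delta> h)"
    unfolding n by (rule le_of_int_ceiling)
  then have "m \<le> of_int (n_plus \<delta> h) * h"
    using assms by (simp add: field_simps)
  then show "4 / sqrt pi \<le> of_int (n_plus \<delta> h) * h" "sqrt \<bar>ln (\<delta>/2)\<bar> \<le> of_int (n_plus \<delta> h) * h"
    by (simp_all add: m_def)
  show "0 < n_plus \<delta> h"
    using assms m by (simp add: n)
qed

text \<open>
  With \<open>X = n\<^sup>+ h\<close>, the inequality \<open>\<alpha>(X + j h) \<ge> (X + j h)\<^sup>2 \<ge> X\<^sup>2 + 2 X j h\<close> makes the tail geometric, of sum at most
  \<open>exp (- t X\<^sup>2) / (sqrt \<pi> t X)\<close>. The exponential is at most \<open>\<delta>/2\<close> because \<open>X\<^sup>2 \<ge> \<bar>ln (\<delta>/2)\<bar>\<close>, and the denominator is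
  at least \<open>4 sqrt t\<close> because \<open>X \<ge> 4 / sqrt \<pi>\<close>; both use \<open>t \<ge> 1\<close>.
\<close>

lemma upper_tail:
  assumes h: "h > 0" and t: "t \<ge> 1" and \<delta>: "0 < \<delta>" "\<delta> < 1" and N: "int N \<ge> n_plus \<delta> h"
  shows "0 \<le> sum (trapezoid_term h t) {- int N..int N} - phi \<delta> h N t"
    and "sum (trapezoid_term h t) {- int N..int N} - phi \<delta> h N t \<le> \<delta> / 8 / sqrt t"
proof -
  define p where "p = n_plus \<delta> h"
  define X where "X = of_int p * h"
  define c where "c = 2 * t * X * h"
  have X: "4 / sqrt pi \<le> X" "sqrt \<bar>ln (\<delta>/2)\<bar> \<le> X" and p: "0 < p"
    unfolding X_def p_def using n_plus_times_step[OF h] by auto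
  have X_pos: "X > 0" using X(1) by (rule less_le_trans[rotated]) simp
  have c: "c > 0" using h t X_pos by (simp add: c_def)
  have split: "{- int N..int N} = {- int N..p} \<union> {p<..int N}"
    using N p by (auto simp: p_def)
  have diff: "sum (trapezoid_term h t) {- int N..int N} - phi \<delta> h N t = sum (trapezoid_term h t) {p<..int N}"
    unfolding split phi_eq_sum p_def[symmetric] by (subst sum.union_disjoint) auto
  show "0 \<le> sum (trapezoid_term h t) {- int N..int N} - phi \<delta> h N t"
    unfolding diff by (intro sum_nonneg trapezoid_term_nonneg[OF h])
  have "trapezoid_term h t (p + int j) \<le> h * (2 / sqrt pi) * exp (- (t * X\<^sup>2)) * exp (- (c * real j))" for j
  proof -
    let ?x = "X + real j * h"
    have x: "of_int (p + int j) * h = ?x"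
      by (simp add: X_def algebra_simps)
    have "0 \<le> ?x" using X_pos h by simp
    then have "?x\<^sup>2 \<le> alpha ?x"
      unfolding alpha_def using le_ln_one_plus_exp by (intro power_mono)
    moreover have "X\<^sup>2 + 2 * X * h * real j \<le> ?x\<^sup>2"
      by (simp add: power2_sum algebra_simps)
    ultimately have "t * (X\<^sup>2 + 2 * X * h * real j) \<le> t * alpha ?x"
      using t by (intro mult_left_mono) auto
    then have "exp (- alpha ?x * t) \<le> exp (- (t * X\<^sup>2)) * exp (- (c * real j))"
      by (simp add: c_def algebra_simps flip: exp_add)
    then have "w ?x * exp (- alpha ?x * t) \<le> (2 / sqrt pi) * (exp (- (t * X\<^sup>2)) * exp (- (c * real j)))"
      by (intro mult_mono[OF w_bounds(2)]) auto
    from mult_left_mono[OF this less_imp_le[OF h]] show ?thesis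
      unfolding trapezoid_term_def x integrand_def by (simp only: mult.assoc)
  qed
  then have "sum (trapezoid_term h t) {p<..int N} \<le> (\<Sum>j=1..nat (int N - p). h * (2 / sqrt pi) * exp (- (t * X\<^sup>2)) * exp (- (c * real j)))"
    unfolding sum_greaterThanAtMost_int_shift by (intro sum_mono)
  also have "\<dots> \<le> h * (2 / sqrt pi) * exp (- (t * X\<^sup>2)) * (1 / c)"
    unfolding sum_distrib_left[symmetric] using h by (intro mult_left_mono sum_exp_tail_le c) auto
  also have "\<dots> = exp (- (t * X\<^sup>2)) * (1 / (sqrt pi * X * t))"
    using h by (simp add: c_def)
  also have "\<dots> \<le> (\<delta> / 2) * (1 / (4 * sqrt t))"
  proof (intro mult_mono)
    have "\<bar>ln (\<delta>/2)\<bar> \<le> X\<^sup>2"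
      using power_mono[OF X(2), of 2] by simp
    also have "X\<^sup>2 \<le> t * X\<^sup>2"
      using t by (simp add: mult_le_cancel_right1)
    finally have "exp (- (t * X\<^sup>2)) \<le> exp (ln (\<delta>/2))"
      unfolding exp_le_cancel_iff by linarith
    then show "exp (- (t * X\<^sup>2)) \<le> \<delta> / 2"
      using \<delta> by simp
    have "4 \<le> sqrt pi * X"
      using X(1) by (simp add: field_simps)
    moreover have "sqrt t \<le> t"
      using t by (intro real_le_lsqrt) (auto simp: power2_eq_square)
    ultimately have "4 * sqrt t \<le> sqrt pi * X * t"
      using t by (intro mult_mono) auto
    then show "1 / (sqrt pi * X * t) \<le> 1 / (4 * sqrt t)"
      using t by (intro divide_left_mono mult_pos_pos X_pos) auto
  qed (use \<delta> t X_pos in auto)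
  finally show "sum (trapezoid_term h t) {- int N..int N} - phi \<delta> h N t \<le> \<delta> / 8 / sqrt t"
    unfolding diff by simp
qed

lemma lower_tail:
  assumes h: "h > 0" and t: "t \<ge> 0" and n: "n \<le> N"
  shows "0 \<le> phi \<delta> h N t - phi \<delta> h n t"
    and "phi \<delta> h N t - phi \<delta> h n t \<le> 2 / sqrt pi * exp (- (real n * h))"
proof -
  have p: "0 < n_plus \<delta> h" by (rule n_plus_times_step[OF h])
  have split: "{- int N..n_plus \<delta> h} = {- int N..<- int n} \<union> {- int n..n_plus \<delta> h}"
    using n p by auto
  have diff: "phi \<delta> h N t - phi \<delta> h n t = sum (trapezoid_term h t) {- int N..<- int n}"
    unfolding phi_eq_sum split by (subst sum.union_disjoint) auto
  show "0 \<le> phi \<delta> h N t - phi \<delta> h n t"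
    unfolding diff by (intro sum_nonneg trapezoid_term_nonneg[OF h])
  have "sum (trapezoid_term h t) {- int N..<- int n} = (\<Sum>k\<in>{int n<..int N}. trapezoid_term h t (- k))"
    by (rule sum.reindex_bij_witness[where i = uminus and j = uminus]) auto
  also have "\<dots> = (\<Sum>j=1..nat (int N - int n). trapezoid_term h t (- (int n + int j)))"
    by (rule sum_greaterThanAtMost_int_shift)
  also have "\<dots> \<le> (\<Sum>j=1..nat (int N - int n). h * (2 / sqrt pi) * exp (- (real n * h)) * exp (- (h * real j)))"
  proof (rule sum_mono)
    fix j
    let ?x = "- (real n * h) - h * real j"
    have x: "of_int (- (int n + int j)) * h = ?x"
      by (simp add: algebra_simps)
    have "integrand t ?x \<le> 2 / sqrt pi * exp ?x * 1"
      unfolding integrand_def by (rule mult_mono[OF w_bounds(3)]) (use t in \<open>simp_all add: alpha_def\<close>)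
    also have "exp ?x = exp (- (real n * h)) * exp (- (h * real j))"
      by (simp flip: exp_add)
    finally have "integrand t ?x \<le> 2 / sqrt pi * (exp (- (real n * h)) * exp (- (h * real j)))"
      by simp
    from mult_left_mono[OF this less_imp_le[OF h]]
    show "trapezoid_term h t (- (int n + int j)) \<le> h * (2 / sqrt pi) * exp (- (real n * h)) * exp (- (h * real j))"
      unfolding trapezoid_term_def x by (simp only: mult.assoc)
  qed
  also have "\<dots> \<le> h * (2 / sqrt pi) * exp (- (real n * h)) * (1 / h)"
    unfolding sum_distrib_left[symmetric] using h by (intro mult_left_mono sum_exp_tail_le) auto
  also have "\<dots> = 2 / sqrt pi * exp (- (real n * h))"
    using h by simp
  finally show "phi \<delta> h N t - phi \<delta> h n t \<le> 2 / sqrt pi * exp (- (real n * h))"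
    unfolding diff .
qed

section \<open>The error estimates\<close>

text \<open>
  The trapezoidal rule with \<open>d = \<pi>/10\<close>. The error sequence \<open>\<epsilon>\<close> collects what vanishes as the rectangle grows:
  the vertical sides and the part of the integral outside \<open>[- R N, R N]\<close>.
\<close>

lemma trapezoidal_error:
  assumes h: "h > 0" and t: "t > 0"
    and q: "q = exp (- (pi\<^sup>2 / (5 * h)))"
  obtains \<epsilon> where "\<epsilon> \<longlonglongrightarrow> 0"
    "\<And>N. \<bar>sum (trapezoid_term h t) {- int N..int N} - 1 / sqrt t\<bar> \<le> q / (1 - q) * (8 * sqrt 2) / sqrt t + \<epsilon> N"
proof -
  define R where "R N = (real N + 1/2) * h" for N
  define g where "g x = sqrt 2 * integrand (t / 16) x" for x
  define \<epsilon> where "\<epsilon> N = 3 * (pi / 10) * (g (- R N) + g (R N)) + \<bar>integral {- R N..R N} (integrand t) - 1 / sqrt t\<bar>" for N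
  have R: "filterlim R at_top sequentially"
    unfolding R_def using h by real_asymp
  have q1: "0 < q" "q < 1" using h by (auto simp: q)
  have "\<epsilon> \<longlonglongrightarrow> 3 * (pi / 10) * (sqrt 2 * 0 + sqrt 2 * 0) + \<bar>1 / sqrt t - 1 / sqrt t\<bar>"
    unfolding \<epsilon>_def g_def
    using t by (intro tendsto_intros integral_integrand_tendsto R filterlim_compose[OF integrand_tendsto_0(1) R]
      filterlim_compose[OF integrand_tendsto_0(2) R]) auto
  then have "\<epsilon> \<longlonglongrightarrow> 0" by simp
  moreover have "\<bar>sum (trapezoid_term h t) {- int N..int N} - 1 / sqrt t\<bar> \<le> q / (1 - q) * (8 * sqrt 2) / sqrt t + \<epsilon> N" for N
  proof -
    let ?S = "sum (trapezoid_term h t) {- int N..int N}" and ?I = "integral {- R N..R N} (integrand t)"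
    have "norm ((\<Sum>k\<in>{- int N..int N}. h * complex_integrand t (of_real (of_int k * h))) - integral {- R N..R N} (\<lambda>x. complex_integrand t (of_real x)))
         \<le> 2 * (q / (1 - q)) * integral {- R N..R N} g + 3 * (pi / 10) * (g (- R N) + g (R N))"
      unfolding R_def
    proof (rule trapezoidal_rule_on_strip[OF _ _ h holomorphic_complex_integrand])
      show "continuous_on UNIV g"
        unfolding g_def by (intro continuous_intros continuous_on_integrand)
      show "norm (complex_integrand t (Complex x y)) \<le> g x" if "\<bar>y\<bar> \<le> pi / 10" for x y
        unfolding g_def using that t by (intro norm_complex_integrand_le) auto
      show "q = exp (- (2 * pi * (pi / 10) / h))"
        by (simp add: q power2_eq_square)
    qed auto
    also have "(\<Sum>k\<in>{- int N..int N}. h * complex_integrand t (of_real (of_int k * h))) = of_real ?S"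
      unfolding complex_integrand_of_real trapezoid_term_def by simp
    also have "integral {- R N..R N} (\<lambda>x. complex_integrand t (of_real x)) = of_real ?I"
      unfolding complex_integrand_of_real
      by (intro integral_unique has_integral_of_real integrable_integral integrable_continuous_interval continuous_on_integrand)
    also have "norm (complex_of_real ?S - of_real ?I) = \<bar>?S - ?I\<bar>"
      by (simp only: norm_of_real flip: of_real_diff)
    finally have "\<bar>?S - ?I\<bar> \<le> 2 * (q / (1 - q)) * integral {- R N..R N} g + 3 * (pi / 10) * (g (- R N) + g (R N))" .
    moreover have "integral {- R N..R N} g \<le> sqrt 2 * (4 / sqrt t)"
    proof -
      have "integral {- R N..R N} g = sqrt 2 * integral {- R N..R N} (integrand (t / 16))"
        unfolding g_def by simp
      also have "\<dots> \<le> sqrt 2 * (1 / sqrt (t / 16))"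
        using t by (intro mult_left_mono integral_integrand_le) auto
      also have "1 / sqrt (t / 16) = 4 / sqrt t"
        by (simp add: real_sqrt_divide)
      finally show ?thesis .
    qed
    moreover from this have "2 * (q / (1 - q)) * integral {- R N..R N} g \<le> 2 * (q / (1 - q)) * (sqrt 2 * (4 / sqrt t))"
      using q1 by (intro mult_left_mono) auto
    ultimately have "\<bar>?S - ?I\<bar> \<le> 2 * (q / (1 - q)) * (sqrt 2 * (4 / sqrt t)) + 3 * (pi / 10) * (g (- R N) + g (R N))"
      by linarith
    then show ?thesis
      unfolding \<epsilon>_def by (simp add: algebra_simps)
  qed
  ultimately show thesis by (rule that)
qed

text \<open>
  The bound on \<open>h\<close> says \<open>\<pi>\<^sup>2 / (5 h) \<ge> \<bar>ln (\<delta>/2)\<bar> + 4\<close>. The summand \<open>\<bar>ln (\<delta>/2)\<bar>\<close> provides the factor \<open>\<delta>/2\<close> in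
  \<open>q\<close>, and the summand \<open>4\<close> absorbs the constants; \<open>exp 4 \<ge> 16\<close> suffices.
\<close>

lemma error_constant:
  assumes \<delta>: "0 < \<delta>" "\<delta> < 1" and h: "h > 0" "h \<le> pi\<^sup>2 / (5 * (\<bar>ln (\<delta>/2)\<bar> + 4))"
    and q: "q = exp (- (pi\<^sup>2 / (5 * h)))"
  shows "q / (1 - q) * (8 * sqrt 2) \<le> 3/8 * \<delta>"
proof -
  define L where "L = \<bar>ln (\<delta>/2)\<bar>"
  have L: "L = - ln (\<delta>/2)" "L \<ge> 0" using \<delta> by (auto simp: L_def)
  have "L + 4 \<le> pi\<^sup>2 / (5 * h)"
    using h L(2) unfolding L_def[symmetric] by (simp add: field_simps)
  then have "q \<le> exp (- (L + 4))"
    by (simp add: q)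
  also have "\<dots> = \<delta> / 2 / exp 1 ^ 4"
  proof -
    have "exp (- (L + 4)) = exp (- L) / exp (4 * 1)"
      by (simp flip: exp_diff)
    also have "exp (- L) = \<delta> / 2"
      using \<delta> by (simp add: L)
    also have "exp (4 * 1 :: real) = exp 1 ^ 4"
      using exp_of_nat_mult[of 4 "1::real"] by simp
    finally show ?thesis .
  qed
  also have "\<dots> \<le> \<delta> / 2 / 2 ^ 4"
    using \<delta> exp_ge_add_one_self[of 1] by (intro divide_left_mono power_mono) auto
  finally have q_le: "q \<le> \<delta> / 32" by simp
  have "sqrt 2 \<le> sqrt ((71/50)\<^sup>2)"
    by (intro real_sqrt_le_mono) (simp add: power2_eq_square)
  then have sqrt2: "sqrt 2 \<le> 71/50" by simp
  have q_pos: "0 < q" by (simp add: q)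
  have "q / (1 - q) * (8 * sqrt 2) \<le> (\<delta> / 32) / (31/32) * (8 * (71/50))"
    using q_pos q_le \<delta> sqrt2 by (intro mult_mono frac_le) auto
  also have "\<dots> \<le> 3/8 * \<delta>" using \<delta> by simp
  finally show ?thesis .
qed

text \<open>
  The two error contributions \<open>3\<delta>/8\<close> and \<open>\<delta>/8\<close> add up to half the permitted error, which leaves room for truncation at \<open>-n\<close>.
\<close>

lemma phi_inf_error:
  assumes \<delta>: "0 < \<delta>" "\<delta> < 1" and h: "h > 0" "h \<le> pi\<^sup>2 / (5 * (\<bar>ln (\<delta>/2)\<bar> + 4))" and t: "t \<ge> 1"
  shows "\<bar>1 / sqrt t - phi_inf \<delta> h t\<bar> \<le> \<delta> / 2 / sqrt t"
proof -
  define q where "q = exp (- (pi\<^sup>2 / (5 * h)))"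
  obtain \<epsilon> where \<epsilon>: "\<epsilon> \<longlonglongrightarrow> 0"
    "\<And>N. \<bar>sum (trapezoid_term h t) {- int N..int N} - 1 / sqrt t\<bar> \<le> q / (1 - q) * (8 * sqrt 2) / sqrt t + \<epsilon> N"
    using trapezoidal_error[OF h(1) _ q_def, of t] t by auto
  have "\<bar>1 / sqrt t - phi \<delta> h N t\<bar> \<le> \<delta> / 2 / sqrt t + \<epsilon> N" if "N \<ge> nat (n_plus \<delta> h)" for N
  proof -
    have "q / (1 - q) * (8 * sqrt 2) / sqrt t \<le> 3/8 * \<delta> / sqrt t"
      using error_constant[OF \<delta> h q_def] t by (intro divide_right_mono) auto
    moreover have "3/8 * \<delta> / sqrt t + \<delta> / 8 / sqrt t = \<delta> / 2 / sqrt t"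
      by (simp add: field_simps)
    moreover have "int N \<ge> n_plus \<delta> h" using that by linarith
    note upper_tail[OF h(1) t \<delta> this]
    ultimately show ?thesis
      using \<epsilon>(2)[of N] by linarith
  qed
  moreover have "(\<lambda>N. \<bar>1 / sqrt t - phi \<delta> h N t\<bar>) \<longlonglongrightarrow> \<bar>1 / sqrt t - phi_inf \<delta> h t\<bar>"
    using h t by (intro tendsto_intros phi_tendsto_phi_inf) auto
  moreover have "(\<lambda>N. \<delta> / 2 / sqrt t + \<epsilon> N) \<longlonglongrightarrow> \<delta> / 2 / sqrt t + 0"
    by (intro tendsto_add tendsto_const \<epsilon>)
  ultimately have "\<bar>1 / sqrt t - phi_inf \<delta> h t\<bar> \<le> \<delta> / 2 / sqrt t + 0"
    using LIMSEQ_le by blast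
  then show ?thesis by simp
qed

text \<open>
  The hypothesis on \<open>n\<close> is \<open>2 / sqrt \<pi> exp (- n h) \<le> exp (- \<bar>ln m\<bar>) / sqrt T\<close> in logarithmic form, and
  \<open>exp (- \<bar>ln m\<bar>) \<le> m\<close> also when \<open>m > 1\<close>.
\<close>

lemma phi_inf_minus_phi:
  assumes h: "h > 0" and t: "0 < t" "t \<le> T" and m: "m > 0"
    and n: "int n \<ge> \<lceil>inverse h * (ln (2 / sqrt pi) + \<bar>ln m\<bar> + 1/2 * ln T)\<rceil>"
  shows "\<bar>phi_inf \<delta> h t - phi \<delta> h n t\<bar> \<le> m / sqrt t"
proof -
  have "inverse h * (ln (2 / sqrt pi) + \<bar>ln m\<bar> + 1/2 * ln T) \<le> real n"
    using n by (simp add: ceiling_le_iff)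
  then have "ln (2 / sqrt pi) + \<bar>ln m\<bar> + 1/2 * ln T \<le> real n * h"
    using h by (simp add: field_simps)
  moreover have "1/2 * ln T = ln (sqrt T)"
    using t by (simp add: ln_sqrt)
  ultimately have "- (real n * h) \<le> ln m - ln (2 / sqrt pi) - ln (sqrt T)"
    by linarith
  then have "exp (- (real n * h)) \<le> exp (ln m - ln (2 / sqrt pi) - ln (sqrt T))"
    by simp
  also have "\<dots> = m / (2 / sqrt pi) / sqrt T"
    using m t by (simp only: exp_diff) simp
  finally have "2 / sqrt pi * exp (- (real n * h)) \<le> 2 / sqrt pi * (m / (2 / sqrt pi) / sqrt T)"
    by (intro mult_left_mono) auto
  also have "\<dots> = m / sqrt T" by simp
  also have "\<dots> \<le> m / sqrt t"
    using m t by (intro divide_left_mono) auto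
  finally have bound: "phi \<delta> h N t - phi \<delta> h n t \<le> m / sqrt t" "0 \<le> phi \<delta> h N t - phi \<delta> h n t" if "n \<le> N" for N
    using lower_tail[OF h less_imp_le[OF t(1)] that, of \<delta>] by auto
  have lim: "(\<lambda>N. phi \<delta> h N t - phi \<delta> h n t) \<longlonglongrightarrow> phi_inf \<delta> h t - phi \<delta> h n t"
    using h t by (intro tendsto_intros phi_tendsto_phi_inf) auto
  have "phi_inf \<delta> h t - phi \<delta> h n t \<le> m / sqrt t"
    using lim by (rule LIMSEQ_le_const2) (use bound(1) in blast)
  moreover have "0 \<le> phi_inf \<delta> h t - phi \<delta> h n t"
    using lim by (rule LIMSEQ_le_const) (use bound(2) in blast)
  ultimately show ?thesis by simp
qed

theorem theorem4p1:
  fixes \<delta> h :: real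
  assumes "\<delta> \<in> {0<..<1}"
    and "h \<in> {0<..pi\<^sup>2 / (5 * (\<bar>ln (\<delta>/2)\<bar> + 4))}"
  shows "(\<forall>t\<in>{1..}. \<bar>1 / sqrt t - phi_inf \<delta> h t\<bar> \<le> \<delta> / sqrt t) \<and>
    (\<forall>(\<eta>::real) (T::real) (n::nat).
       \<eta> > 0 \<longrightarrow> T > 1 \<longrightarrow>
       int n \<ge> \<lceil>inverse h * (ln (2 * pi powr (-1/2)) + \<bar>ln (min (\<delta>/2) \<eta>)\<bar> + 1/2 * ln T)\<rceil> \<longrightarrow>
       (\<forall>t\<in>{1..T}. \<bar>t powr (-1/2) - phi \<delta> h n t\<bar> \<le> \<delta> / sqrt t \<and>
                   \<bar>phi_inf \<delta> h t - phi \<delta> h n t\<bar> \<le> \<eta> / sqrt t))"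
proof (intro conjI ballI allI impI)
  have \<delta>: "0 < \<delta>" "\<delta> < 1" and h: "h > 0" "h \<le> pi\<^sup>2 / (5 * (\<bar>ln (\<delta>/2)\<bar> + 4))"
    using assms by auto
  note error = phi_inf_error[OF \<delta> h]
  {
    fix t :: real
    assume t: "t \<in> {1..}"
    then have "\<delta> / 2 / sqrt t \<le> \<delta> / sqrt t"
      using \<delta> by (intro divide_right_mono) auto
    then show "\<bar>1 / sqrt t - phi_inf \<delta> h t\<bar> \<le> \<delta> / sqrt t"
      using error[of t] t by auto
  }
  fix \<eta> T :: real and n :: nat and t :: real
  assume \<eta>: "\<eta> > 0" and "T > 1"
    and n: "int n \<ge> \<lceil>inverse h * (ln (2 * pi powr (-1/2)) + \<bar>ln (min (\<delta>/2) \<eta>)\<bar> + 1/2 * ln T)\<rceil>"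
    and t: "t \<in> {1..T}"
  have "\<bar>phi_inf \<delta> h t - phi \<delta> h n t\<bar> \<le> min (\<delta>/2) \<eta> / sqrt t"
  proof (rule phi_inf_minus_phi[OF h(1)])
    show "int n \<ge> \<lceil>inverse h * (ln (2 / sqrt pi) + \<bar>ln (min (\<delta>/2) \<eta>)\<bar> + 1/2 * ln T)\<rceil>"
      using n by (simp only: powr_minus_half[OF pi_gt_zero] times_divide_eq_right mult_1_right)
  qed (use \<delta> \<eta> t in auto)
  moreover have "min (\<delta>/2) \<eta> / sqrt t \<le> \<delta> / 2 / sqrt t" "min (\<delta>/2) \<eta> / sqrt t \<le> \<eta> / sqrt t"
    using t by (intro divide_right_mono; simp)+
  moreover have "\<bar>1 / sqrt t - phi_inf \<delta> h t\<bar> \<le> \<delta> / 2 / sqrt t"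
    using error t by simp
  moreover have "\<delta> / 2 / sqrt t + \<delta> / 2 / sqrt t = \<delta> / sqrt t"
    by (simp add: field_simps)
  moreover have "t powr (-1/2) = 1 / sqrt t"
    using t by (intro powr_minus_half) auto
  ultimately show "\<bar>t powr (-1/2) - phi \<delta> h n t\<bar> \<le> \<delta> / sqrt t" "\<bar>phi_inf \<delta> h t - phi \<delta> h n t\<bar> \<le> \<eta> / sqrt t"
    by linarith+
qed

end
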